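(* Let $q>1$, $A\in\mathbb R^{m\times N}$, $b\in\mathbb R^m$, $E\in\mathbb R^{r\times N}$, $\sigma>0$, let $\|\cdot\|_\star$ be a norm on $\mathbb R^r$, and let $\mathcal C\subseteq\mathbb R^N$ be a polyhedral set. The following hold. (i) Let $x_*$ be a minimizer of $(P_2)$: $\min_{x\in\mathbb R^N}\frac12\|Ax-b\|_q^q+\|Ex\|_\star$ subject to $x\in\mathcal C$. Then $z_*$ is a minimizer of $(P_2)$ if and only if $z_*$ is a minimizer of the BP-like problem $(P_1)$: $\min_{z\in\mathbb R^N}\|Ez\|_\star$ subject to $Az=Ax_*$ and $z\in\mathcal C$. Furthermore, the optimal value of this $(P_1)$ equals $\|Ex_*\|_\star$. (ii) Consider $(P_3)$: $\min_{x\in\mathbb R^N}\|Ex\|_\star$ subject to $\|Ax-b\|_q\le\sigma$ and $x\in\mathcal C$, and suppose that $\|b\|_q>\sigma$, $0\in\mathcal C$, and the optimal value of $(P_3)$ is positive. Let $x_*$ be a minimizer of $(P_3)$. Then $z_*$ is a minimizer of $(P_3)$ if and only if $z_*$ is a minimizer of the problem $\min_{z\in\mathbb R^N}\|Ez\|_\star$ subject to $Az=Ax_*$ and $z\in\mathcal C$; and the optimal value of the latter problem equals $\|Ex_*\|_\star$.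
   Context: $\|\cdot\|_q$ denotes the $\ell_q$-norm on $\mathbb R^m$. *)

theory Defs
  imports "HOL-Analysis.Analysis"
begin

definition lq_norm :: "real \<Rightarrow> real ^ 'm \<Rightarrow> real" where
  "lq_norm q x = (\<Sum>i\<in>UNIV. \<bar>x $ i\<bar> powr q) powr (1 / q)"

text \<open>An arbitrary norm on a real vector space, independent of the one fixed by the type class
  \<open>real_normed_vector\<close>. Nonnegativity follows from these three axioms.\<close>

definition is_norm :: "('a::real_vector \<Rightarrow> real) \<Rightarrow> bool" where
  "is_norm \<nu> \<longleftrightarrow>
     (\<forall>x. \<nu> x = 0 \<longleftrightarrow> x = 0) \<and>
     (\<forall>c x. \<nu> (c *\<^sub>R x) = \<bar>c\<bar> * \<nu> x) \<and>
     (\<forall>x y. \<nu> (x + y) \<le> \<nu> x + \<nu> y)"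

text \<open>The feasible set is given as a predicate, to match \<^const>\<open>is_arg_min\<close>. Taking the infimum
  in the extended reals gives the value \<open>\<infinity>\<close> to an infeasible problem and \<open>-\<infinity>\<close> to an unbounded
  one, which the real-valued infimum would not.\<close>

definition optimal_value :: "('a \<Rightarrow> real) \<Rightarrow> ('a \<Rightarrow> bool) \<Rightarrow> ereal" where
  "optimal_value f P = (INF x\<in>{x. P x}. ereal (f x))"

end

theory Submission
  imports Defs
begin

text \<open>The function \<open>y \<mapsto> \<parallel>y\<parallel>\<^sub>q\<^sup>q\<close> is strictly convex, so all minimizers of \<open>P\<^sub>2\<close> share one
  residual: otherwise their midpoint would do better. In \<open>P\<^sub>3\<close> the midpoint of two minimizers with
  different residuals satisfies the residual constraint strictly, so it can be moved slightly towards
  the origin while staying feasible, which decreases the positive objective. Once every minimizer lies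
  in the fibre \<open>A z = A x\<^sub>*\<close>, the claims follow since on this fibre the original objective is
  \<open>\<parallel>E z\<parallel>\<^sub>\<star>\<close> up to a constant.\<close>

text \<open>The derivative \<open>q * x powr (q - 1)\<close> is strictly increasing on the positive
  reals, so the mean value theorem on either side of \<open>c\<close> keeps the graph strictly above
  its tangent there. The endpoint \<open>y = 0\<close> is separate, since the derivative is only
  taken at positive points.\<close>

lemma powr_gt_tangent:
  fixes c y q :: real
  assumes "q > 1" "c > 0" "y \<ge> 0" "y \<noteq> c"
  shows "y powr q > c powr q + q * c powr (q - 1) * (y - c)"
proof (cases "y = 0")
  case True
  have "c powr (q - 1) * c = c powr q"
    using \<open>c > 0\<close> by (simp add: powr_diff)
  moreover have "c powr q < q * c powr q"
    using assms by simp
  ultimately show ?thesis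
    using True by (simp add: algebra_simps)
next
  case False
  with assms have "y > 0" by simp
  have D: "DERIV (\<lambda>x. x powr q) x :> q * x powr (q - 1)" if "x > 0" for x :: real
    using has_real_derivative_powr[OF that] by simp
  show ?thesis
  proof (cases "y < c")
    case True
    obtain x where x: "y < x" "x < c" "c powr q - y powr q = (c - y) * (q * x powr (q - 1))"
      using MVT2[OF True, of "\<lambda>x. x powr q" "\<lambda>x. q * x powr (q - 1)"] D \<open>y > 0\<close> by force
    have "x powr (q - 1) < c powr (q - 1)"
      using x \<open>y > 0\<close> \<open>q > 1\<close> by (intro powr_less_mono2) auto
    then have "(c - y) * (q * x powr (q - 1)) < (c - y) * (q * c powr (q - 1))"
      using True \<open>q > 1\<close> by (intro mult_strict_left_mono) auto
    then show ?thesis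
      using x(3) by (simp add: algebra_simps)
  next
    case False
    with assms have "c < y" by simp
    obtain x where x: "c < x" "x < y" "y powr q - c powr q = (y - c) * (q * x powr (q - 1))"
      using MVT2[OF \<open>c < y\<close>, of "\<lambda>x. x powr q" "\<lambda>x. q * x powr (q - 1)"] D \<open>c > 0\<close> by force
    have "c powr (q - 1) < x powr (q - 1)"
      using x \<open>c > 0\<close> \<open>q > 1\<close> by (intro powr_less_mono2) auto
    then have "(y - c) * (q * c powr (q - 1)) < (y - c) * (q * x powr (q - 1))"
      using \<open>c < y\<close> \<open>q > 1\<close> by (intro mult_strict_left_mono) auto
    then show ?thesis
      using x(3) by (simp add: algebra_simps)
  qed
qed

text \<open>Take the tangent of the q-th power at the absolute value of the convex combination,
  evaluate it at \<open>\<bar>a\<bar>\<close> and \<open>\<bar>b\<bar>\<close>, and average.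
  Strictness survives unless both of these equal the point of tangency.\<close>

lemma abs_powr_strict_convex:
  fixes a b q t :: real
  assumes "q > 1" "0 < t" "t < 1" "a \<noteq> b"
  shows "\<bar>(1 - t) * a + t * b\<bar> powr q < (1 - t) * \<bar>a\<bar> powr q + t * \<bar>b\<bar> powr q"
proof (cases "(1 - t) * a + t * b = 0")
  \<comment> \<open>The tangent bound needs a positive base point. Here the left side is 0, and the
    right side is positive because \<open>a\<close> and \<open>b\<close> cannot both vanish.\<close>
  case True
  have "a \<noteq> 0 \<or> b \<noteq> 0" using assms by auto
  then have "0 < (1 - t) * \<bar>a\<bar> powr q + t * \<bar>b\<bar> powr q"
  proof
    assume "a \<noteq> 0"
    then show ?thesis using assms by (intro add_pos_nonneg) auto
  next
    assume "b \<noteq> 0"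
    then show ?thesis using assms by (intro add_nonneg_pos) auto
  qed
  with True show ?thesis by simp
next
  case False
  define c where "c = \<bar>(1 - t) * a + t * b\<bar>"
  define k where "k = q * c powr (q - 1)"
  have c: "c > 0" and k: "k > 0"
    using False \<open>q > 1\<close> by (auto simp: c_def k_def)
  have le: "c \<le> (1 - t) * \<bar>a\<bar> + t * \<bar>b\<bar>"
    unfolding c_def using assms abs_triangle_ineq[of "(1 - t) * a" "t * b"]
    by (simp add: abs_mult)
  have tangent: "c powr q + k * (\<bar>x\<bar> - c) \<le> \<bar>x\<bar> powr q"
    and strict: "\<bar>x\<bar> \<noteq> c \<Longrightarrow> c powr q + k * (\<bar>x\<bar> - c) < \<bar>x\<bar> powr q" for x
    using powr_gt_tangent[OF \<open>q > 1\<close> c, of "\<bar>x\<bar>"] by (cases "\<bar>x\<bar> = c"; simp add: k_def)+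
  \<comment> \<open>If both absolute values were \<open>c\<close>, then \<open>b = - a\<close> and
    the combination would be \<open>(1 - 2 * t) * a\<close>, whose absolute value is below
    \<open>c\<close> for \<open>t\<close> strictly between 0 and 1.\<close>
  have ne: "\<bar>a\<bar> \<noteq> c \<or> \<bar>b\<bar> \<noteq> c"
  proof (rule ccontr)
    assume "\<not> ?thesis"
    then have ab: "\<bar>a\<bar> = c" "\<bar>b\<bar> = c" by auto
    with \<open>a \<noteq> b\<close> have b: "b = - a" by (auto simp: abs_if split: if_splits)
    have "c = \<bar>(1 - 2 * t) * a\<bar>" unfolding c_def b by (simp add: algebra_simps)
    then have "c = \<bar>1 - 2 * t\<bar> * c" using ab by (simp add: abs_mult)
    with c have "\<bar>1 - 2 * t\<bar> = 1" by simp
    with assms show False by (simp add: abs_if split: if_splits)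
  qed
  \<comment> \<open>The slope \<open>k\<close> is positive, so the triangle inequality
    \<open>le\<close> makes the added term nonnegative.\<close>
  have "c powr q \<le> c powr q + k * ((1 - t) * \<bar>a\<bar> + t * \<bar>b\<bar> - c)"
    using le k by simp
  also have "\<dots> = (1 - t) * (c powr q + k * (\<bar>a\<bar> - c)) + t * (c powr q + k * (\<bar>b\<bar> - c))"
    by (simp add: algebra_simps)
  also have "\<dots> < (1 - t) * \<bar>a\<bar> powr q + t * \<bar>b\<bar> powr q"
    using ne
  proof
    assume "\<bar>a\<bar> \<noteq> c"
    then show ?thesis
      using assms by (intro add_less_le_mono mult_strict_left_mono mult_left_mono strict tangent) auto
  next
    assume "\<bar>b\<bar> \<noteq> c"
    then show ?thesis
      using assms by (intro add_le_less_mono mult_strict_left_mono mult_left_mono strict tangent) auto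
  qed
  finally show ?thesis unfolding c_def .
qed

lemma lq_norm_powr:
  assumes "q > 1"
  shows "lq_norm q x powr q = (\<Sum>i\<in>UNIV. \<bar>x $ i\<bar> powr q)"
  using assms by (simp add: lq_norm_def powr_powr sum_nonneg)

text \<open>Restates the constraint through the q-th power, which is strictly convex; the norm
  itself is linear along rays and so is not.\<close>

lemma lq_norm_le_iff:
  assumes "q > 1" "\<sigma> > 0"
  shows "lq_norm q x \<le> \<sigma> \<longleftrightarrow> lq_norm q x powr q \<le> \<sigma> powr q"
  using assms powr_less_mono2[of q \<sigma> "lq_norm q x"] powr_mono2[of q "lq_norm q x" \<sigma>]
  by (fastforce simp: lq_norm_def)

text \<open>The q-th power of the norm is a sum over coordinates: equal coordinates contribute
  equality, and at least one coordinate differs and contributes a strict inequality.\<close>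

lemma lq_norm_powr_strict_convex:
  assumes "q > 1" "0 < t" "t < 1" "x \<noteq> y"
  shows "lq_norm q ((1 - t) *\<^sub>R x + t *\<^sub>R y) powr q
    < (1 - t) * lq_norm q x powr q + t * lq_norm q y powr q"
proof -
  have strict: "\<bar>((1 - t) *\<^sub>R x + t *\<^sub>R y) $ i\<bar> powr q
      < (1 - t) * \<bar>x $ i\<bar> powr q + t * \<bar>y $ i\<bar> powr q" if "x $ i \<noteq> y $ i" for i
    using abs_powr_strict_convex[OF assms(1-3) that] by simp
  obtain j where "x $ j \<noteq> y $ j"
    using \<open>x \<noteq> y\<close> by (auto simp: vec_eq_iff)
  then have "(\<Sum>i\<in>UNIV. \<bar>((1 - t) *\<^sub>R x + t *\<^sub>R y) $ i\<bar> powr q)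
      < (\<Sum>i\<in>UNIV. (1 - t) * \<bar>x $ i\<bar> powr q + t * \<bar>y $ i\<bar> powr q)"
  proof (intro sum_strict_mono_ex1 ballI bexI)
    fix i
    show "\<bar>((1 - t) *\<^sub>R x + t *\<^sub>R y) $ i\<bar> powr q
        \<le> (1 - t) * \<bar>x $ i\<bar> powr q + t * \<bar>y $ i\<bar> powr q"
    proof (cases "x $ i = y $ i")
      case True
      then show ?thesis by (simp add: algebra_simps)
    qed (use strict in \<open>auto intro: less_imp_le\<close>)
  qed (use strict in auto)
  then show ?thesis
    using \<open>q > 1\<close> by (simp add: lq_norm_powr sum.distrib sum_distrib_left)
qed

lemma is_norm_zero:
  assumes "is_norm \<nu>"
  shows "\<nu> 0 = 0"
  using assms by (simp add: is_norm_def)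

lemma is_norm_scaleR:
  assumes "is_norm \<nu>"
  shows "\<nu> (c *\<^sub>R x) = \<bar>c\<bar> * \<nu> x"
  using assms by (simp add: is_norm_def)

lemma is_norm_triangle:
  assumes "is_norm \<nu>"
  shows "\<nu> (x + y) \<le> \<nu> x + \<nu> y"
  using assms by (simp add: is_norm_def)

lemma is_norm_convex_matrix:
  fixes E :: "real ^ 'n ^ 'r"
  assumes "is_norm \<nu>" "0 \<le> t" "t \<le> 1"
  shows "\<nu> (E *v ((1 - t) *\<^sub>R x + t *\<^sub>R y)) \<le> (1 - t) * \<nu> (E *v x) + t * \<nu> (E *v y)"
proof -
  have "\<nu> ((1 - t) *\<^sub>R (E *v x) + t *\<^sub>R (E *v y))
      \<le> \<nu> ((1 - t) *\<^sub>R (E *v x)) + \<nu> (t *\<^sub>R (E *v y))"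
    by (rule is_norm_triangle[OF assms(1)])
  then show ?thesis
    using assms(2,3)
    by (simp add: is_norm_scaleR[OF assms(1)] matrix_vector_right_distrib matrix_vector_mult_scaleR)
qed

lemma matrix_residual_convex_comb:
  fixes A :: "real ^ 'n ^ 'm"
  shows "A *v ((1 - t) *\<^sub>R x + t *\<^sub>R y) - b = (1 - t) *\<^sub>R (A *v x - b) + t *\<^sub>R (A *v y - b)"
  by (simp add: matrix_vector_right_distrib matrix_vector_mult_scaleR algebra_simps)

lemma optimal_value_arg_min:
  assumes "is_arg_min f P x"
  shows "optimal_value f P = ereal (f x)"
  unfolding optimal_value_def
  using assms by (intro antisym INF_lower2[of x] INF_greatest) (auto simp: is_arg_min_linorder)

text \<open>The step shared by both claims: \<open>Q\<close> will be the fibre through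
  \<open>x\<close>, and \<open>c\<close> the part of the objective that is constant on it. Since
  \<open>x\<close> itself lies in \<open>Q\<close>, restricting to \<open>Q\<close> loses no
  optimum.\<close>

lemma arg_min_on_subset:
  fixes f h :: "'a \<Rightarrow> real"
  assumes "is_arg_min f P x"
    and "\<And>z. is_arg_min f P z \<Longrightarrow> Q z"
    and "\<And>z. Q z \<Longrightarrow> P z"
    and "\<And>z. Q z \<Longrightarrow> f z = c + h z"
  shows "(\<forall>z. is_arg_min f P z \<longleftrightarrow> is_arg_min h Q z) \<and> optimal_value h Q = ereal (h x)"
proof -
  have eq: "is_arg_min f P z \<longleftrightarrow> is_arg_min h Q z" for z
  proof
    assume z: "is_arg_min f P z"
    with assms(2) have "Q z" .
    with z assms(3,4) show "is_arg_min h Q z"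
      by (fastforce simp: is_arg_min_linorder)
  next
    assume z: "is_arg_min h Q z"
    then have "Q z" "h z \<le> h x"
      using assms(1,2) by (auto simp: is_arg_min_linorder)
    then show "is_arg_min f P z"
      using assms(2)[OF assms(1)] assms(3,4) by (intro is_arg_min_antimono[OF assms(1)]) auto
  qed
  with assms(1) show ?thesis
    by (simp add: optimal_value_arg_min)
qed

lemma penalized_minimizers_same_image:
  fixes A :: "real ^ 'n ^ 'm" and E :: "real ^ 'n ^ 'r"
  assumes "q > 1" "is_norm \<nu>" "convex C"
    and x: "is_arg_min (\<lambda>x. 1 / 2 * lq_norm q (A *v x - b) powr q + \<nu> (E *v x)) (\<lambda>x. x \<in> C) x"
    and y: "is_arg_min (\<lambda>x. 1 / 2 * lq_norm q (A *v x - b) powr q + \<nu> (E *v x)) (\<lambda>x. x \<in> C) y"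
  shows "A *v y = A *v x"
proof (rule ccontr)
  assume "A *v y \<noteq> A *v x"
  then have ne: "A *v x - b \<noteq> A *v y - b" by simp
  define w where "w = (1 - 1/2) *\<^sub>R x + (1/2) *\<^sub>R y"
  have "w \<in> C"
    unfolding w_def using x y by (intro convexD[OF \<open>convex C\<close>]) (auto simp: is_arg_min_def)
  moreover have "lq_norm q (A *v w - b) powr q
      < (1 - 1/2) * lq_norm q (A *v x - b) powr q + 1/2 * lq_norm q (A *v y - b) powr q"
    unfolding w_def matrix_residual_convex_comb
    by (rule lq_norm_powr_strict_convex[OF \<open>q > 1\<close> _ _ ne]) auto
  moreover have "\<nu> (E *v w) \<le> (1 - 1/2) * \<nu> (E *v x) + 1/2 * \<nu> (E *v y)"
    unfolding w_def by (rule is_norm_convex_matrix[OF \<open>is_norm \<nu>\<close>]) auto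
  \<comment> \<open>Adding the two bounds puts the objective at \<open>w\<close> below the average
    of its values at \<open>x\<close> and \<open>y\<close>, hence below at least one of these
    minima.\<close>
  ultimately show False
    using x y by (fastforce simp: is_arg_min_linorder)
qed

text \<open>The origin lies in \<open>C\<close> but violates the residual constraint, so the segment
  from a strictly feasible midpoint to the origin leaves the feasible set only after a positive
  step, and that step shrinks the objective.\<close>

lemma constrained_minimizers_same_image:
  fixes A :: "real ^ 'n ^ 'm" and E :: "real ^ 'n ^ 'r"
  assumes "q > 1" "\<sigma> > 0" "is_norm \<nu>" "convex C" "0 \<in> C" "lq_norm q b > \<sigma>" "\<nu> (E *v x) > 0"
    and x: "is_arg_min (\<lambda>x. \<nu> (E *v x)) (\<lambda>x. lq_norm q (A *v x - b) \<le> \<sigma> \<and> x \<in> C) x"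
    and y: "is_arg_min (\<lambda>x. \<nu> (E *v x)) (\<lambda>x. lq_norm q (A *v x - b) \<le> \<sigma> \<and> x \<in> C) y"
  shows "A *v y = A *v x"
proof (rule ccontr)
  assume "A *v y \<noteq> A *v x"
  then have ne: "A *v x - b \<noteq> A *v y - b" by simp
  define g where "g z = lq_norm q (A *v z - b) powr q" for z
  define s where "s = \<sigma> powr q"
  have feas: "lq_norm q (A *v z - b) \<le> \<sigma> \<longleftrightarrow> g z \<le> s" for z
    unfolding g_def s_def by (rule lq_norm_le_iff[OF assms(1,2)])
  have xy: "g x \<le> s" "g y \<le> s" "x \<in> C" "y \<in> C" "\<nu> (E *v y) \<le> \<nu> (E *v x)"
    using x y by (auto simp: is_arg_min_linorder feas)
  define w where "w = (1 - 1/2) *\<^sub>R x + (1/2) *\<^sub>R y"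
  have w: "w \<in> C"
    unfolding w_def using xy by (intro convexD[OF \<open>convex C\<close>]) auto
  have "g w < (1 - 1/2) * g x + 1/2 * g y"
    unfolding w_def g_def matrix_residual_convex_comb
    by (rule lq_norm_powr_strict_convex[OF \<open>q > 1\<close> _ _ ne]) auto
  with xy have gw: "g w < s" by simp
  have "\<nu> (E *v w) \<le> (1 - 1/2) * \<nu> (E *v x) + 1/2 * \<nu> (E *v y)"
    unfolding w_def by (rule is_norm_convex_matrix[OF \<open>is_norm \<nu>\<close>]) auto
  with xy have nw: "\<nu> (E *v w) \<le> \<nu> (E *v x)" by simp
  have "lq_norm q (A *v 0 - b) = lq_norm q b"
    by (simp add: lq_norm_def)
  with assms(6) feas[of 0] have g0: "g 0 > s" by simp
  \<comment> \<open>The convexity bound \<open>(1 - t) * g w + t * g 0\<close> on the residual of \<open>(1 - t) *\<^sub>R w\<close> equals \<open>s\<close>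
    for this \<open>t\<close>.\<close>
  define t where "t = (s - g w) / (g 0 - g w)"
  have t: "0 < t" "t < 1" "t * (g 0 - g w) = s - g w"
    using gw g0 by (auto simp: t_def)
  \<comment> \<open>This is \<open>(1 - t) *\<^sub>R w\<close>, written as a combination with the
    origin so that the convexity lemmas apply.\<close>
  define v where "v = (1 - t) *\<^sub>R w + t *\<^sub>R 0"
  have "A *v w - b \<noteq> A *v 0 - b"
    using gw g0 by (auto simp: g_def)
  then have "g v < (1 - t) * g w + t * g 0"
    unfolding v_def g_def matrix_residual_convex_comb
    by (intro lq_norm_powr_strict_convex[OF \<open>q > 1\<close>] t)
  also have "\<dots> = s"
    using t(3) by (simp add: algebra_simps)
  finally have "g v \<le> s" by simp
  moreover have "v \<in> C"
    unfolding v_def using w \<open>0 \<in> C\<close> t by (intro convexD[OF \<open>convex C\<close>]) auto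
  ultimately have "\<nu> (E *v x) \<le> \<nu> (E *v v)"
    using x by (simp add: is_arg_min_linorder feas)
  also have "\<dots> \<le> (1 - t) * \<nu> (E *v w)"
    using is_norm_convex_matrix[OF \<open>is_norm \<nu>\<close>, of t E w 0] t
    by (simp add: v_def is_norm_zero[OF \<open>is_norm \<nu>\<close>])
  also have "\<dots> \<le> (1 - t) * \<nu> (E *v x)"
    using nw t by (intro mult_left_mono) auto
  \<comment> \<open>Positivity of the optimal value makes the scaling by \<open>1 - t\<close> a
    strict decrease.\<close>
  also have "\<dots> < \<nu> (E *v x)"
    using t \<open>\<nu> (E *v x) > 0\<close> by (simp add: algebra_simps)
  finally show False by simp
qed

theorem proposition2p2:
  fixes q \<sigma> :: real
    and A :: "real ^ 'n ^ 'm" and b :: "real ^ 'm"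
    and E :: "real ^ 'n ^ 'r" and norm_star :: "real ^ 'r \<Rightarrow> real"
    and C :: "(real ^ 'n) set"
  assumes "q > 1" and "\<sigma> > 0" and "is_norm norm_star" and "polyhedron C"
  shows
    "(\<forall>xs. is_arg_min (\<lambda>x. 1 / 2 * lq_norm q (A *v x - b) powr q + norm_star (E *v x))
                      (\<lambda>x. x \<in> C) xs \<longrightarrow>
        (\<forall>zs. is_arg_min (\<lambda>x. 1 / 2 * lq_norm q (A *v x - b) powr q + norm_star (E *v x))
                         (\<lambda>x. x \<in> C) zs \<longleftrightarrow>
              is_arg_min (\<lambda>z. norm_star (E *v z)) (\<lambda>z. A *v z = A *v xs \<and> z \<in> C) zs) \<and>
        optimal_value (\<lambda>z. norm_star (E *v z)) (\<lambda>z. A *v z = A *v xs \<and> z \<in> C)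
          = ereal (norm_star (E *v xs)))
     \<and>
     (lq_norm q b > \<sigma> \<longrightarrow> 0 \<in> C \<longrightarrow>
      optimal_value (\<lambda>x. norm_star (E *v x)) (\<lambda>x. lq_norm q (A *v x - b) \<le> \<sigma> \<and> x \<in> C) > 0 \<longrightarrow>
      (\<forall>xs. is_arg_min (\<lambda>x. norm_star (E *v x))
                       (\<lambda>x. lq_norm q (A *v x - b) \<le> \<sigma> \<and> x \<in> C) xs \<longrightarrow>
        (\<forall>zs. is_arg_min (\<lambda>x. norm_star (E *v x))
                         (\<lambda>x. lq_norm q (A *v x - b) \<le> \<sigma> \<and> x \<in> C) zs \<longleftrightarrow>
              is_arg_min (\<lambda>z. norm_star (E *v z)) (\<lambda>z. A *v z = A *v xs \<and> z \<in> C) zs) \<and>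
        optimal_value (\<lambda>z. norm_star (E *v z)) (\<lambda>z. A *v z = A *v xs \<and> z \<in> C)
          = ereal (norm_star (E *v xs))))"
proof -
  have "convex C"
    using \<open>polyhedron C\<close> by (rule polyhedron_imp_convex)
  show ?thesis
  proof ((rule conjI; intro allI impI), goal_cases)
    case (1 xs)
    have "A *v zs = A *v xs \<and> zs \<in> C"
      if "is_arg_min (\<lambda>x. 1 / 2 * lq_norm q (A *v x - b) powr q + norm_star (E *v x))
        (\<lambda>x. x \<in> C) zs" for zs
      using penalized_minimizers_same_image[OF \<open>q > 1\<close> \<open>is_norm norm_star\<close> \<open>convex C\<close> 1 that]
        that
      by (simp add: is_arg_min_def)
    \<comment> \<open>On the fibre the residual term is frozen at its value for \<open>xs\<close>,
      which serves as the constant.\<close>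
    then show ?case
      by (rule arg_min_on_subset[OF 1, where c = "1 / 2 * lq_norm q (A *v xs - b) powr q"]) simp_all
  next
    case (2 xs)
    have feas: "lq_norm q (A *v xs - b) \<le> \<sigma>"
      using 2(4) by (simp add: is_arg_min_def)
    have pos: "norm_star (E *v xs) > 0"
      using 2(3) optimal_value_arg_min[OF 2(4)] by simp
    have "A *v zs = A *v xs \<and> zs \<in> C"
      if "is_arg_min (\<lambda>x. norm_star (E *v x))
        (\<lambda>x. lq_norm q (A *v x - b) \<le> \<sigma> \<and> x \<in> C) zs" for zs
      using constrained_minimizers_same_image[OF assms(1-3) \<open>convex C\<close> 2(2,1) pos 2(4) that] that
      by (simp add: is_arg_min_def)
    then show ?case
      \<comment> \<open>The objectives agree, and points of the fibre inherit the residual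
        constraint from \<open>xs\<close> because it depends only on the image under
        \<open>A\<close>.\<close>
      by (rule arg_min_on_subset[OF 2(4), where c = 0]) (use feas in simp_all)
  qed
qed

end
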